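(* Let $W$ be the complex Lie algebra with basis $\{L_m, I_m \mid m\in\mathbb{Z}\}$ and bracket $[L_m,L_n]=(m-n)L_{m+n}$, $[L_m,I_n]=(m-n)I_{m+n}$, $[I_m,I_n]=0$ for all $m,n\in\mathbb{Z}$. Let $\alpha,\beta$ be the skew-symmetric bilinear forms on $W$ determined by $$\alpha(L_m,L_n)=\delta_{m+n,0}\frac{m^3-m}{12},\quad \alpha(L_m,I_n)=\alpha(I_m,I_n)=0,$$ $$\beta(L_m,I_n)=\delta_{m+n,0}\frac{m^3-m}{12},\quad \beta(L_m,L_n)=\beta(I_m,I_n)=0,$$ for all $m,n\in\mathbb{Z}$. Then $\alpha$ and $\beta$ are 2-cocycles on $W$ and $$H^2(W,\mathbb{C})=\mathbb{C}\alpha\oplus\mathbb{C}\beta,$$ i.e. the classes of $\alpha$ and $\beta$ form a basis of $H^2(W,\mathbb{C})$.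
   Context: For a perfect complex Lie algebra $\mathfrak{g}$, a 2-cocycle is a bilinear map $\psi:\mathfrak{g}\times\mathfrak{g}\to\mathbb{C}$ with $\psi(x,y)=-\psi(y,x)$ and $\psi([x,y],z)+\psi([y,z],x)+\psi([z,x],y)=0$ for all $x,y,z\in\mathfrak g$. A 2-coboundary is a 2-cocycle of the form $(x,y)\mapsto f([x,y])$ for a linear function $f:\mathfrak{g}\to\mathbb{C}$. $H^2(\mathfrak{g},\mathbb{C})$ is the quotient of the vector space of 2-cocycles by the subspace of 2-coboundaries. *)

theory Defs
  imports
    "HOL-Library.Poly_Mapping"
    "HOL-Library.Product_Plus"
    "HOL-Algebra.AbelCoset"
    "Jordan_Normal_Form.VS_Connect"
begin

section \<open>Quotients of modules\<close>

text \<open>The multiplicative fields of the underlying ring record play no role for modules.\<close>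

definition quotient_module ::
    "('a, 'b, 'm) module_scheme \<Rightarrow> 'b set \<Rightarrow> ('a, 'b set) Module.module" where
  "quotient_module M N =
     \<lparr>carrier = a_rcosets\<^bsub>M\<^esub> N, mult = undefined, one = undefined,
      zero = N, add = set_add M,
      smult = (\<lambda>c A. \<Union>x\<in>A. N +>\<^bsub>M\<^esub> (c \<odot>\<^bsub>M\<^esub> x))\<rparr>"

lemma quotient_module_vectorspace:
  fixes K :: "('a, 'k) ring_scheme" and V :: "('a, 'b, 'm) module_scheme"
  assumes V: "vectorspace K V" and N: "VectorSpace.subspace K N V"
  shows "vectorspace K (quotient_module V N)"
proof -
  interpret V: vectorspace K V by (fact V)
  have "submodule K N V"
    using N by (simp add: VectorSpace.subspace_def)
  then have sub: "N \<subseteq> carrier V" and Nz: "\<zero>\<^bsub>V\<^esub> \<in> N"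
    and Nadd: "\<And>x y. x \<in> N \<Longrightarrow> y \<in> N \<Longrightarrow> x \<oplus>\<^bsub>V\<^esub> y \<in> N"
    and Nsm: "\<And>c x. c \<in> carrier K \<Longrightarrow> x \<in> N \<Longrightarrow> c \<odot>\<^bsub>V\<^esub> x \<in> N"
    by (auto simp: submodule_def)
  have Nminus: "\<ominus>\<^bsub>V\<^esub> x \<in> N" if "x \<in> N" for x
  proof -
    have "(\<ominus>\<^bsub>K\<^esub> \<one>\<^bsub>K\<^esub>) \<odot>\<^bsub>V\<^esub> x \<in> N" using that by (intro Nsm) auto
    then show ?thesis using that sub by (simp add: V.smult_l_minus subset_iff)
  qed
  have "subgroup N (add_monoid V)"
    using sub Nz Nadd Nminus
    by (intro group.subgroupI[OF V.a_group]) (auto simp: a_inv_def)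
  then interpret S: abelian_subgroup N V
    by (intro abelian_subgroupI2 V.a_comm_group)
  let ?Q = "quotient_module V N"
  have carrier_Q: "A \<in> carrier ?Q \<longleftrightarrow> (\<exists>x\<in>carrier V. A = N +>\<^bsub>V\<^esub> x)" for A
    by (auto simp: quotient_module_def A_RCOSETS_def RCOSETS_def a_r_coset_def)
  have add_Q: "(N +>\<^bsub>V\<^esub> x) \<oplus>\<^bsub>?Q\<^esub> (N +>\<^bsub>V\<^esub> y) = N +>\<^bsub>V\<^esub> (x \<oplus>\<^bsub>V\<^esub> y)"
    if "x \<in> carrier V" "y \<in> carrier V" for x y
    using that by (simp add: quotient_module_def S.a_rcos_sum)
  have coset_N: "N +>\<^bsub>V\<^esub> (h \<oplus>\<^bsub>V\<^esub> x) = N +>\<^bsub>V\<^esub> x" if "h \<in> N" "x \<in> carrier V" for h x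
  proof -
    have "h \<in> carrier V" using that sub by auto
    then have "N +>\<^bsub>V\<^esub> (h \<oplus>\<^bsub>V\<^esub> x) = (N +>\<^bsub>V\<^esub> h) +>\<^bsub>V\<^esub> x"
      by (rule V.a_coset_add_assoc[OF sub _ that(2), symmetric])
    then show ?thesis by (simp only: S.a_rcos_const[OF that(1)])
  qed
  have smult_Q: "c \<odot>\<^bsub>?Q\<^esub> (N +>\<^bsub>V\<^esub> x) = N +>\<^bsub>V\<^esub> (c \<odot>\<^bsub>V\<^esub> x)"
    if c: "c \<in> carrier K" and x: "x \<in> carrier V" for c x
  proof -
    have "N +>\<^bsub>V\<^esub> (c \<odot>\<^bsub>V\<^esub> y) = N +>\<^bsub>V\<^esub> (c \<odot>\<^bsub>V\<^esub> x)" if "y \<in> N +>\<^bsub>V\<^esub> x" for y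
    proof -
      from that obtain h where h: "h \<in> N" "y = h \<oplus>\<^bsub>V\<^esub> x"
        by (auto simp: a_r_coset_def')
      then show ?thesis
        using c x sub Nsm by (simp add: V.smult_r_distr coset_N subset_iff)
    qed
    moreover have "x \<in> N +>\<^bsub>V\<^esub> x" using x by (rule S.a_rcos_self)
    ultimately have "(\<Union>y\<in>N +>\<^bsub>V\<^esub> x. N +>\<^bsub>V\<^esub> (c \<odot>\<^bsub>V\<^esub> y)) = N +>\<^bsub>V\<^esub> (c \<odot>\<^bsub>V\<^esub> x)"
      by blast
    then show ?thesis by (simp add: quotient_module_def)
  qed
  have zero_Q: "\<zero>\<^bsub>?Q\<^esub> = N +>\<^bsub>V\<^esub> \<zero>\<^bsub>V\<^esub>"
    using S.a_rcos_const[OF Nz] by (simp add: quotient_module_def)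
  have "abelian_group ?Q"
  proof (rule abelian_groupI)
    fix A B C assume "A \<in> carrier ?Q" "B \<in> carrier ?Q" "C \<in> carrier ?Q"
    then obtain x y z where x: "x \<in> carrier V" "A = N +>\<^bsub>V\<^esub> x"
      and y: "y \<in> carrier V" "B = N +>\<^bsub>V\<^esub> y" and z: "z \<in> carrier V" "C = N +>\<^bsub>V\<^esub> z"
      by (auto simp: carrier_Q)
    show "A \<oplus>\<^bsub>?Q\<^esub> B \<oplus>\<^bsub>?Q\<^esub> C = A \<oplus>\<^bsub>?Q\<^esub> (B \<oplus>\<^bsub>?Q\<^esub> C)"
      using x y z by (simp add: add_Q V.a_assoc)
  next
    fix A B assume "A \<in> carrier ?Q" "B \<in> carrier ?Q"
    then obtain x y where x: "x \<in> carrier V" "A = N +>\<^bsub>V\<^esub> x"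
      and y: "y \<in> carrier V" "B = N +>\<^bsub>V\<^esub> y"
      by (auto simp: carrier_Q)
    show "A \<oplus>\<^bsub>?Q\<^esub> B = B \<oplus>\<^bsub>?Q\<^esub> A"
      using x y by (simp add: add_Q V.a_comm)
    show "A \<oplus>\<^bsub>?Q\<^esub> B \<in> carrier ?Q"
      unfolding carrier_Q using x y by (intro bexI[of _ "x \<oplus>\<^bsub>V\<^esub> y"]) (simp_all add: add_Q)
  next
    fix A assume "A \<in> carrier ?Q"
    then obtain x where x: "x \<in> carrier V" "A = N +>\<^bsub>V\<^esub> x" by (auto simp: carrier_Q)
    show "\<zero>\<^bsub>?Q\<^esub> \<oplus>\<^bsub>?Q\<^esub> A = A"
      using x by (simp add: add_Q zero_Q)
    have "N +>\<^bsub>V\<^esub> (\<ominus>\<^bsub>V\<^esub> x) \<in> carrier ?Q"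
      unfolding carrier_Q using x by blast
    moreover have "(N +>\<^bsub>V\<^esub> (\<ominus>\<^bsub>V\<^esub> x)) \<oplus>\<^bsub>?Q\<^esub> A = \<zero>\<^bsub>?Q\<^esub>"
      using x by (simp add: add_Q zero_Q V.l_neg)
    ultimately show "\<exists>B\<in>carrier ?Q. B \<oplus>\<^bsub>?Q\<^esub> A = \<zero>\<^bsub>?Q\<^esub>" by blast
  next
    show "\<zero>\<^bsub>?Q\<^esub> \<in> carrier ?Q"
      unfolding carrier_Q zero_Q by blast
  qed
  moreover have "module_axioms K ?Q"
  proof (rule module_axioms.intro)
    fix c A assume c: "c \<in> carrier K" and "A \<in> carrier ?Q"
    then obtain x where x: "x \<in> carrier V" "A = N +>\<^bsub>V\<^esub> x" by (auto simp: carrier_Q)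
    show "c \<odot>\<^bsub>?Q\<^esub> A \<in> carrier ?Q"
      unfolding carrier_Q using c x
      by (intro bexI[of _ "c \<odot>\<^bsub>V\<^esub> x"]) (simp_all add: smult_Q)
  qed (auto simp: carrier_Q add_Q smult_Q V.smult_l_distr V.smult_r_distr V.smult_assoc1)
  ultimately show ?thesis
    by (intro vectorspace.intro Module.module.intro V.field_axioms V.R.is_cring)
qed

section \<open>Second cohomology of a complex Lie algebra with trivial coefficients\<close>

locale complex_lie_algebra = vector_space scale
  for scale :: "complex \<Rightarrow> 'w::ab_group_add \<Rightarrow> 'w" +
  fixes bracket :: "'w \<Rightarrow> 'w \<Rightarrow> 'w"
  assumes bracket_linear_right: "Vector_Spaces.linear scale scale (bracket x)"
    and bracket_linear_left: "Vector_Spaces.linear scale scale (\<lambda>x. bracket x y)"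
    and bracket_self: "bracket x x = 0"
    and jacobi: "bracket (bracket x y) z + bracket (bracket y z) x + bracket (bracket z x) y = 0"

definition bilinear_form ::
    "(complex \<Rightarrow> 'w::ab_group_add \<Rightarrow> 'w) \<Rightarrow> ('w \<Rightarrow> 'w \<Rightarrow> complex) \<Rightarrow> bool" where
  "bilinear_form scale \<psi> \<longleftrightarrow>
     (\<forall>x. Vector_Spaces.linear scale (*) (\<psi> x)) \<and>
     (\<forall>y. Vector_Spaces.linear scale (*) (\<lambda>x. \<psi> x y))"

definition skew_symmetric :: "('w \<Rightarrow> 'w \<Rightarrow> complex) \<Rightarrow> bool" where
  "skew_symmetric \<psi> \<longleftrightarrow> (\<forall>x y. \<psi> x y = - \<psi> y x)"

definition two_cocycle ::
    "(complex \<Rightarrow> 'w::ab_group_add \<Rightarrow> 'w) \<Rightarrow> ('w \<Rightarrow> 'w \<Rightarrow> 'w) \<Rightarrow> ('w \<Rightarrow> 'w \<Rightarrow> complex) \<Rightarrow> bool" where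
  "two_cocycle scale bracket \<psi> \<longleftrightarrow>
     bilinear_form scale \<psi> \<and> skew_symmetric \<psi> \<and>
     (\<forall>x y z. \<psi> (bracket x y) z + \<psi> (bracket y z) x + \<psi> (bracket z x) y = 0)"

definition two_coboundary ::
    "(complex \<Rightarrow> 'w::ab_group_add \<Rightarrow> 'w) \<Rightarrow> ('w \<Rightarrow> 'w \<Rightarrow> 'w) \<Rightarrow> ('w \<Rightarrow> 'w \<Rightarrow> complex) \<Rightarrow> bool" where
  "two_coboundary scale bracket \<psi> \<longleftrightarrow>
     two_cocycle scale bracket \<psi> \<and>
     (\<exists>f. Vector_Spaces.linear scale (*) f \<and> \<psi> = (\<lambda>x y. f (bracket x y)))"

definition Z2 ::
    "(complex \<Rightarrow> 'w::ab_group_add \<Rightarrow> 'w) \<Rightarrow> ('w \<Rightarrow> 'w \<Rightarrow> 'w) \<Rightarrow>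
      (complex, 'w \<Rightarrow> 'w \<Rightarrow> complex) Module.module" where
  "Z2 scale bracket =
     \<lparr>carrier = {\<psi>. two_cocycle scale bracket \<psi>}, mult = undefined, one = undefined,
      zero = (\<lambda>x y. 0), add = (\<lambda>\<phi> \<psi> x y. \<phi> x y + \<psi> x y),
      smult = (\<lambda>c \<psi> x y. c * \<psi> x y)\<rparr>"

definition B2 ::
    "(complex \<Rightarrow> 'w::ab_group_add \<Rightarrow> 'w) \<Rightarrow> ('w \<Rightarrow> 'w \<Rightarrow> 'w) \<Rightarrow> ('w \<Rightarrow> 'w \<Rightarrow> complex) set" where
  "B2 scale bracket = {\<psi>. two_coboundary scale bracket \<psi>}"

definition H2 ::
    "(complex \<Rightarrow> 'w::ab_group_add \<Rightarrow> 'w) \<Rightarrow> ('w \<Rightarrow> 'w \<Rightarrow> 'w) \<Rightarrow>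
      (complex, ('w \<Rightarrow> 'w \<Rightarrow> complex) set) Module.module" where
  "H2 scale bracket = quotient_module (Z2 scale bracket) (B2 scale bracket)"

definition H2_class ::
    "(complex \<Rightarrow> 'w::ab_group_add \<Rightarrow> 'w) \<Rightarrow> ('w \<Rightarrow> 'w \<Rightarrow> 'w) \<Rightarrow>
      ('w \<Rightarrow> 'w \<Rightarrow> complex) \<Rightarrow> ('w \<Rightarrow> 'w \<Rightarrow> complex) set" where
  "H2_class scale bracket \<psi> = B2 scale bracket +>\<^bsub>Z2 scale bracket\<^esub> \<psi>"

lemma Z2_vectorspace:
  assumes "complex_lie_algebra scale bracket"
  shows "vectorspace class_ring (Z2 scale bracket)"
proof -
  interpret complex_lie_algebra scale bracket by (fact assms)
  let ?Z = "Z2 scale bracket"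
  have vsc: "vector_space ((*) :: complex \<Rightarrow> complex \<Rightarrow> complex)"
    by unfold_locales (auto simp: algebra_simps)
  have add: "two_cocycle scale bracket (\<lambda>x y. \<phi> x y + \<psi> x y)"
    if "two_cocycle scale bracket \<phi>" "two_cocycle scale bracket \<psi>" for \<phi> \<psi>
  proof -
    have "\<phi> (bracket x y) z + \<psi> (bracket x y) z + (\<phi> (bracket y z) x + \<psi> (bracket y z) x) +
        (\<phi> (bracket z x) y + \<psi> (bracket z x) y) = 0" for x y z
    proof -
      have "\<phi> (bracket x y) z + \<phi> (bracket y z) x + \<phi> (bracket z x) y = 0"
        "\<psi> (bracket x y) z + \<psi> (bracket y z) x + \<psi> (bracket z x) y = 0"
        using that unfolding two_cocycle_def by blast+
      then show ?thesis by (metis (no_types, lifting) add.assoc add.commute add.left_commute add_0)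
    qed
    moreover have "\<phi> x y + \<psi> x y = - (\<phi> y x + \<psi> y x)" for x y
    proof -
      have "\<phi> x y = - \<phi> y x" "\<psi> x y = - \<psi> y x"
        using that unfolding two_cocycle_def skew_symmetric_def by blast+
      then show ?thesis by simp
    qed
    moreover have "bilinear_form scale \<phi>" "bilinear_form scale \<psi>"
      using that by (simp_all add: two_cocycle_def)
    then have "bilinear_form scale (\<lambda>x y. \<phi> x y + \<psi> x y)"
      by (auto simp: bilinear_form_def Vector_Spaces.linear_iff algebra_simps)
    ultimately show ?thesis unfolding two_cocycle_def skew_symmetric_def by blast
  qed
  have smult: "two_cocycle scale bracket (\<lambda>x y. c * \<psi> x y)"
    if "two_cocycle scale bracket \<psi>" for c \<psi>
  proof -
    have "c * \<psi> (bracket x y) z + c * \<psi> (bracket y z) x + c * \<psi> (bracket z x) y = 0" for x y z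
    proof -
      have "\<psi> (bracket x y) z + \<psi> (bracket y z) x + \<psi> (bracket z x) y = 0"
        using that unfolding two_cocycle_def by blast
      then show ?thesis by (metis distrib_left mult_zero_right)
    qed
    moreover have "c * \<psi> x y = - (c * \<psi> y x)" for x y
    proof -
      have "\<psi> x y = - \<psi> y x"
        using that unfolding two_cocycle_def skew_symmetric_def by blast
      then show ?thesis by simp
    qed
    moreover have "bilinear_form scale \<psi>"
      using that by (simp add: two_cocycle_def)
    then have "bilinear_form scale (\<lambda>x y. c * \<psi> x y)"
      by (auto simp: bilinear_form_def Vector_Spaces.linear_iff algebra_simps)
    ultimately show ?thesis unfolding two_cocycle_def skew_symmetric_def by blast
  qed
  have zero: "two_cocycle scale bracket (\<lambda>x y. 0)"
    by (simp add: two_cocycle_def bilinear_form_def skew_symmetric_def Vector_Spaces.linear_iff vsc vector_space_axioms)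
  have "abelian_group ?Z"
  proof (rule abelian_groupI)
    fix \<psi> assume "\<psi> \<in> carrier ?Z"
    then show "\<exists>\<phi>\<in>carrier ?Z. \<phi> \<oplus>\<^bsub>?Z\<^esub> \<psi> = \<zero>\<^bsub>?Z\<^esub>"
      using smult[of \<psi> "-1"] by (intro bexI[of _ "\<lambda>x y. -1 * \<psi> x y"]) (auto simp: Z2_def)
  qed (auto simp: Z2_def add zero algebra_simps)
  moreover have "module_axioms class_ring ?Z"
    by (rule module_axioms.intro) (auto simp: Z2_def smult algebra_simps)
  ultimately show ?thesis
    by (intro vectorspace.intro Module.module.intro class_field class_cring.cring_axioms)
qed

lemma B2_subspace:
  assumes "complex_lie_algebra scale bracket"
  shows "VectorSpace.subspace class_ring (B2 scale bracket) (Z2 scale bracket)"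
proof -
  interpret complex_lie_algebra scale bracket by (fact assms)
  interpret Z: vectorspace class_ring "Z2 scale bracket" by (rule Z2_vectorspace[OF assms])
  have vsc: "vector_space ((*) :: complex \<Rightarrow> complex \<Rightarrow> complex)"
    by unfold_locales (auto simp: algebra_simps)
  have B2: "\<psi> \<in> B2 scale bracket \<longleftrightarrow> \<psi> \<in> carrier (Z2 scale bracket) \<and>
      (\<exists>f. Vector_Spaces.linear scale (*) f \<and> \<psi> = (\<lambda>x y. f (bracket x y)))" for \<psi>
    by (simp add: B2_def Z2_def two_coboundary_def)
  have "submodule class_ring (B2 scale bracket) (Z2 scale bracket)"
  proof (rule submodule.intro)
    show "Module.module class_ring (Z2 scale bracket)" by (rule Z.module_axioms)
    show "B2 scale bracket \<subseteq> carrier (Z2 scale bracket)" by (auto simp: B2)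
    show "\<zero>\<^bsub>Z2 scale bracket\<^esub> \<in> B2 scale bracket"
      unfolding B2
      by (intro conjI Z.M.zero_closed exI[of _ "\<lambda>x. 0"])
        (simp_all add: Z2_def Vector_Spaces.linear_iff vsc vector_space_axioms)
  next
    fix \<phi> \<psi> assume \<phi>: "\<phi> \<in> B2 scale bracket" and \<psi>: "\<psi> \<in> B2 scale bracket"
    then obtain f g where "Vector_Spaces.linear scale (*) f" "\<phi> = (\<lambda>x y. f (bracket x y))"
      "Vector_Spaces.linear scale (*) g" "\<psi> = (\<lambda>x y. g (bracket x y))"
      by (auto simp: B2)
    then show "\<phi> \<oplus>\<^bsub>Z2 scale bracket\<^esub> \<psi> \<in> B2 scale bracket"
      unfolding B2 using \<phi> \<psi>
      by (intro conjI Z.M.a_closed exI[of _ "\<lambda>x. f x + g x"])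
        (simp_all add: B2 Z2_def Vector_Spaces.linear_iff algebra_simps)
  next
    fix c and \<psi> assume c: "c \<in> carrier (class_ring :: complex ring)" and \<psi>: "\<psi> \<in> B2 scale bracket"
    then obtain f where "Vector_Spaces.linear scale (*) f" "\<psi> = (\<lambda>x y. f (bracket x y))"
      by (auto simp: B2)
    then show "c \<odot>\<^bsub>Z2 scale bracket\<^esub> \<psi> \<in> B2 scale bracket"
      unfolding B2 using c \<psi>
      by (intro conjI Z.smult_closed exI[of _ "\<lambda>x. c * f x"])
        (simp_all add: B2 Z2_def Vector_Spaces.linear_iff algebra_simps)
  qed
  then show ?thesis
    by (intro VectorSpace.subspace.intro Z.vectorspace_axioms)
qed

lemma H2_vectorspace:
  assumes "complex_lie_algebra scale bracket"
  shows "vectorspace class_ring (H2 scale bracket)"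
  unfolding H2_def
  by (intro quotient_module_vectorspace Z2_vectorspace B2_subspace assms)

section \<open>The Lie algebra W\<close>

locale lie_algebra_W = complex_lie_algebra scale bracket
  for scale :: "complex \<Rightarrow> 'w::ab_group_add \<Rightarrow> 'w" and bracket :: "'w \<Rightarrow> 'w \<Rightarrow> 'w" +
  fixes L I :: "int \<Rightarrow> 'w"
  assumes inj_L: "inj L" and inj_I: "inj I" and L_I_disjoint: "range L \<inter> range I = {}"
    and basis_independent: "\<not> dependent (range L \<union> range I)"
    and basis_span: "span (range L \<union> range I) = UNIV"
    and bracket_L_L: "bracket (L m) (L n) = scale (of_int (m - n)) (L (m + n))"
    and bracket_L_I: "bracket (L m) (I n) = scale (of_int (m - n)) (I (m + n))"
    and bracket_I_I: "bracket (I m) (I n) = 0"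

text \<open>
  Such a Lie algebra exists: with \<open>D = t d/dt\<close> acting on Laurent polynomials, take pairs of
  Laurent polynomials with \<open>L m = (t^m, 0)\<close>, \<open>I m = (0, t^m)\<close> and
  \<open>[(f, u), (g, v)] = (D f * g - f * D g, D f * v - f * D v - (D g * u - g * D u))\<close>.
\<close>

lemma poly_mapping_single_add_induct [case_names single sum]:
  fixes f :: "'a \<Rightarrow>\<^sub>0 'b::comm_monoid_add"
  assumes single: "\<And>k a. P (Poly_Mapping.single k a)"
    and sum: "\<And>f g. P f \<Longrightarrow> P g \<Longrightarrow> P (f + g)"
  shows "P f"
proof (induction f rule: update_induct)
  case const
  show ?case using single[of _ 0] by simp
next
  case (update f a b)
  have "Poly_Mapping.update a b f = Poly_Mapping.single a b + f"
    using update(1) by (intro poly_mapping_eqI)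
      (auto simp: lookup_update lookup_add lookup_single when_def in_keys_iff)
  then show ?case using sum[OF single update(3)] by simp
qed

lemma lie_algebra_W_exists:
  "\<exists>(scale :: complex \<Rightarrow> (int \<Rightarrow>\<^sub>0 complex) \<times> (int \<Rightarrow>\<^sub>0 complex) \<Rightarrow> _) bracket L I.
     lie_algebra_W scale bracket L I"
proof -
  define C :: "complex \<Rightarrow> int \<Rightarrow>\<^sub>0 complex" where "C = Poly_Mapping.single 0"
  define D :: "(int \<Rightarrow>\<^sub>0 complex) \<Rightarrow> (int \<Rightarrow>\<^sub>0 complex)"
    where "D = Poly_Mapping.mapp (\<lambda>k a. of_int k * a)"
  have lookup_D: "Poly_Mapping.lookup (D f) k = of_int k * Poly_Mapping.lookup f k" for f k
    by (simp add: D_def lookup_mapp when_def in_keys_iff)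
  have D_add: "D (f + g) = D f + D g" for f g
    by (rule poly_mapping_eqI) (simp add: lookup_D lookup_add algebra_simps)
  have D_diff: "D (f - g) = D f - D g" for f g
    by (rule poly_mapping_eqI) (simp add: lookup_D lookup_minus algebra_simps)
  have D_single: "D (Poly_Mapping.single k a) = Poly_Mapping.single k (of_int k * a)" for k a
    by (rule poly_mapping_eqI) (simp add: lookup_D lookup_single when_def)
  have D_0 [simp]: "D 0 = 0"
    by (rule poly_mapping_eqI) (simp add: lookup_D)
  have D_mult: "D (f * g) = D f * g + f * D g" for f g
  proof (induction f rule: poly_mapping_single_add_induct)
    case (single k a)
    show ?case
    proof (induction g rule: poly_mapping_single_add_induct)
      case (single l b)
      show ?case
        by (simp add: D_single mult_single flip: single_add) (simp add: algebra_simps)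
    next
      case (sum f1 f2)
      then show ?case by (simp add: D_add algebra_simps)
    qed
  next
    case (sum f1 f2)
    then show ?case by (simp add: D_add algebra_simps)
  qed
  have D_C: "D (C c * f) = C c * D f" for c f
    by (simp add: D_mult D_single C_def)
  have C_add: "C (a + b) = C a + C b" for a b by (simp add: C_def single_add)
  have C_mult: "C (a * b) = C a * C b" for a b by (simp add: C_def mult_single)
  have C_1: "C 1 = 1" by (simp add: C_def)

  define scale where "scale c p = (C c * fst p, C c * snd p)"
    for c and p :: "(int \<Rightarrow>\<^sub>0 complex) \<times> (int \<Rightarrow>\<^sub>0 complex)"
  define w where "w f g = D f * g - f * D g" for f g
  define bracket where "bracket p q = (w (fst p) (fst q), w (fst p) (snd q) - w (fst q) (snd p))"
    for p q :: "(int \<Rightarrow>\<^sub>0 complex) \<times> (int \<Rightarrow>\<^sub>0 complex)"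
  define L I :: "int \<Rightarrow> (int \<Rightarrow>\<^sub>0 complex) \<times> (int \<Rightarrow>\<^sub>0 complex)"
    where "L = (\<lambda>m. (Poly_Mapping.single m 1, 0))" and "I = (\<lambda>m. (0, Poly_Mapping.single m 1))"

  interpret V: vector_space scale
    by unfold_locales (auto simp: scale_def C_add C_mult C_1 algebra_simps prod_eq_iff)
  interpret LA: complex_lie_algebra scale bracket
  proof unfold_locales
    fix x y z :: "(int \<Rightarrow>\<^sub>0 complex) \<times> (int \<Rightarrow>\<^sub>0 complex)" and c
    show "bracket x (y + z) = bracket x y + bracket x z"
      by (simp add: bracket_def w_def D_add algebra_simps prod_eq_iff)
    show "bracket x (scale c y) = scale c (bracket x y)"
      by (simp add: bracket_def w_def scale_def D_C algebra_simps prod_eq_iff)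
    show "bracket (x + y) z = bracket x z + bracket y z"
      by (simp add: bracket_def w_def D_add algebra_simps prod_eq_iff)
    show "bracket (scale c x) y = scale c (bracket x y)"
      by (simp add: bracket_def w_def scale_def D_C algebra_simps prod_eq_iff)
    show "bracket x x = 0"
      by (simp add: bracket_def w_def algebra_simps prod_eq_iff)
    show "bracket (bracket x y) z + bracket (bracket y z) x + bracket (bracket z x) y = 0"
      by (simp add: bracket_def w_def D_diff D_add D_mult algebra_simps prod_eq_iff)
  qed
  have scale_nth: "Poly_Mapping.lookup (fst (scale c p)) k = c * Poly_Mapping.lookup (fst p) k"
    "Poly_Mapping.lookup (snd (scale c p)) k = c * Poly_Mapping.lookup (snd p) k" for c p k
    by (simp_all add: scale_def C_def map.rep_eq when_def flip: mult_map_scale_conv_mult)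
  have single_inj: "Poly_Mapping.single m (1::complex) = Poly_Mapping.single n 1 \<longleftrightarrow> m = n"
    for m n :: int
    by (metis lookup_single_eq lookup_single_not_eq zero_neq_one)
  have single_nz: "Poly_Mapping.single m (1::complex) \<noteq> 0" for m :: int
    by (metis lookup_single_eq lookup_zero zero_neq_one)
  have "lie_algebra_W scale bracket L I"
  proof
    show inj: "inj L" "inj I"
      by (auto simp: L_def I_def inj_def single_inj)
    show disj: "range L \<inter> range I = {}"
      by (auto simp: L_def I_def single_nz)
    show "\<not> V.dependent (range L \<union> range I)"
      unfolding V.independent_explicit_finite_subsets
    proof (intro allI impI ballI)
      fix S u v
      assume S: "S \<subseteq> range L \<union> range I" "finite S" and 0: "(\<Sum>x\<in>S. scale (u x) x) = 0" and v: "v \<in> S"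
      define \<phi> where "\<phi> p =
        (if v \<in> range L then Poly_Mapping.lookup (fst p) (the_inv L v)
         else Poly_Mapping.lookup (snd p) (the_inv I v))"
        for p :: "(int \<Rightarrow>\<^sub>0 complex) \<times> (int \<Rightarrow>\<^sub>0 complex)"
      have \<phi>_sum: "\<phi> (sum f S) = (\<Sum>x\<in>S. \<phi> (f x))" for f
        by (simp add: \<phi>_def fst_sum snd_sum lookup_sum)
      have \<phi>_v: "\<phi> x = (if x = v then 1 else 0)" if "x \<in> S" for x
      proof -
        have coords: "Poly_Mapping.lookup (fst (L k)) m = (if k = m then 1 else 0)"
          "Poly_Mapping.lookup (snd (L k)) m = 0" "Poly_Mapping.lookup (fst (I k)) m = 0"
          "Poly_Mapping.lookup (snd (I k)) m = (if k = m then 1 else 0)" for k m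
          by (simp_all add: L_def I_def lookup_single when_def)
        have L_I: "L k \<noteq> I m" "I m \<noteq> L k" "I m \<notin> range L" for k m
          using disj by auto
        from S v consider m where "v = L m" | m where "v = I m" by blast
        then show ?thesis
        proof cases
          case 1
          from S that consider k where "x = L k" | k where "x = I k" by blast
          then show ?thesis
            by cases (simp_all add: 1 \<phi>_def coords L_I the_inv_f_f inj inj_eq)
        next
          case 2
          from S that consider k where "x = L k" | k where "x = I k" by blast
          then show ?thesis
            by cases (simp_all add: 2 \<phi>_def coords L_I the_inv_f_f inj inj_eq)
        qed
      qed
      have "0 = \<phi> (\<Sum>x\<in>S. scale (u x) x)" by (simp add: 0) (simp add: \<phi>_def)
      also have "\<dots> = (\<Sum>x\<in>S. u x * \<phi> x)"
        unfolding \<phi>_sum by (rule sum.cong) (auto simp: \<phi>_def scale_nth)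
      also have "\<dots> = (\<Sum>x\<in>S. if x = v then u x else 0)"
        by (rule sum.cong) (auto simp: \<phi>_v)
      also have "\<dots> = u v" using v S by simp
      finally show "u v = 0" by simp
    qed
    have single_C: "Poly_Mapping.single k a = C a * Poly_Mapping.single k 1" for k a
      by (simp add: C_def mult_single)
    have L_span: "(f, 0) \<in> V.span (range L \<union> range I)" for f
    proof (induction f rule: poly_mapping_single_add_induct)
      case (single k a)
      have "(Poly_Mapping.single k a, 0) = scale a (L k)"
        by (simp add: scale_def L_def single_C[of k a])
      moreover have "scale a (L k) \<in> V.span (range L \<union> range I)"
        by (intro V.span_scale V.span_base) auto
      ultimately show ?case by (simp only:)
    next
      case (sum f1 f2)
      from V.span_add[OF this(1,2)] show ?case by simp
    qed
    have I_span: "(0, f) \<in> V.span (range L \<union> range I)" for f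
    proof (induction f rule: poly_mapping_single_add_induct)
      case (single k a)
      have "(0, Poly_Mapping.single k a) = scale a (I k)"
        by (simp add: scale_def I_def single_C[of k a])
      moreover have "scale a (I k) \<in> V.span (range L \<union> range I)"
        by (intro V.span_scale V.span_base) auto
      ultimately show ?case by (simp only:)
    next
      case (sum f1 f2)
      from V.span_add[OF this(1,2)] show ?case by simp
    qed
    have "p \<in> V.span (range L \<union> range I)" for p
      using V.span_add[OF L_span[of "fst p"] I_span[of "snd p"]] by simp
    then show "V.span (range L \<union> range I) = UNIV" by blast
  next
    fix m n
    have w_single: "w (Poly_Mapping.single m 1) (Poly_Mapping.single n 1) =
        C (of_int (m - n)) * Poly_Mapping.single (m + n) 1"
      by (simp add: w_def D_single mult_single C_def flip: single_diff)
    show "bracket (L m) (L n) = scale (of_int (m - n)) (L (m + n))"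
      using w_single by (simp add: bracket_def L_def scale_def) (simp add: w_def)
    show "bracket (L m) (I n) = scale (of_int (m - n)) (I (m + n))"
      using w_single by (simp add: bracket_def L_def I_def scale_def) (simp add: w_def)
    show "bracket (I m) (I n) = 0"
      by (simp add: bracket_def I_def w_def prod_eq_iff)
  qed
  then show ?thesis by blast
qed

end

theory Submission
  imports Defs
begin

text \<open>
  Evaluating the cocycle identity of \<open>\<psi>\<close> on \<open>L 0\<close> and two basis vectors shows that, up to a coboundary,
  \<open>\<psi>\<close> vanishes on pairs of basis vectors whose indices do not sum to zero. On the remaining pairs
  the identity becomes a functional equation for \<open>h m = \<psi> (L m) (X (- m))\<close>, where \<open>X\<close> is \<open>L\<close> or \<open>I\<close>,
  whose solutions are the combinations of \<open>m\<close> and \<open>m\<^sup>3 - m\<close>: the first is a coboundary and the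
  second belongs to \<open>\<alpha>\<close> or \<open>\<beta>\<close>. The same identity forces \<open>\<psi> (I m) (I n) = 0\<close>. Conversely, if
  \<open>a \<alpha> + b \<beta>\<close> is the coboundary of \<open>f\<close>, then the pairs of index \<open>(1, -1)\<close> give
  \<open>f (L 0) = f (I 0) = 0\<close> and the pairs of index \<open>(2, -2)\<close> give \<open>a = b = 0\<close>.
\<close>

section \<open>Bases of quotient spaces\<close>

text \<open>Gives access to the coset calculus of \<open>abelian_subgroup\<close>; closure under
  negation comes from scaling by minus one.\<close>

lemma subspace_abelian_subgroup:
  assumes V: "vectorspace K V" and N: "VectorSpace.subspace K N V"
  shows "abelian_subgroup N V"
proof -
  interpret V: vectorspace K V by (fact V)
  have sub: "submodule K N V" using N by (simp add: VectorSpace.subspace_def)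
  have "\<ominus>\<^bsub>V\<^esub> x \<in> N" if "x \<in> N" for x
  proof -
    have "(\<ominus>\<^bsub>K\<^esub> \<one>\<^bsub>K\<^esub>) \<odot>\<^bsub>V\<^esub> x \<in> N" using that sub by (auto simp: submodule_def)
    then show ?thesis using that sub by (simp add: submodule_def V.smult_l_minus subset_iff)
  qed
  then have "subgroup N (add_monoid V)"
    using sub by (intro group.subgroupI[OF V.a_group]) (auto simp: a_inv_def submodule_def)
  then show ?thesis by (intro abelian_subgroupI2 V.a_comm_group)
qed

lemma quotient_module_zero_iff:
  assumes V: "vectorspace K V" and N: "VectorSpace.subspace K N V" and x: "x \<in> carrier V"
  shows "N +>\<^bsub>V\<^esub> x = \<zero>\<^bsub>quotient_module V N\<^esub> \<longleftrightarrow> x \<in> N"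
proof -
  interpret abelian_subgroup N V by (rule subspace_abelian_subgroup[OF V N])
  show ?thesis using a_rcos_self[OF x] a_rcos_const by (auto simp: quotient_module_def)
qed

text \<open>Scalar multiplication in the quotient is a union over all representatives of a coset.
  Every representative yields the same coset because \<open>N\<close> is closed under scaling, so
  the union collapses.\<close>

lemma quotient_module_lincomb2:
  assumes V: "vectorspace K V" and N: "VectorSpace.subspace K N V"
    and u: "u \<in> carrier V" and v: "v \<in> carrier V" and a: "a \<in> carrier K" and b: "b \<in> carrier K"
  shows "a \<odot>\<^bsub>quotient_module V N\<^esub> (N +>\<^bsub>V\<^esub> u) \<oplus>\<^bsub>quotient_module V N\<^esub>
      b \<odot>\<^bsub>quotient_module V N\<^esub> (N +>\<^bsub>V\<^esub> v) = N +>\<^bsub>V\<^esub> (a \<odot>\<^bsub>V\<^esub> u \<oplus>\<^bsub>V\<^esub> b \<odot>\<^bsub>V\<^esub> v)"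
proof -
  interpret V: vectorspace K V by (fact V)
  interpret S: abelian_subgroup N V by (rule subspace_abelian_subgroup[OF V N])
  have sub: "submodule K N V" using N by (simp add: VectorSpace.subspace_def)
  have smult: "c \<odot>\<^bsub>quotient_module V N\<^esub> (N +>\<^bsub>V\<^esub> x) = N +>\<^bsub>V\<^esub> (c \<odot>\<^bsub>V\<^esub> x)"
    if c: "c \<in> carrier K" and x: "x \<in> carrier V" for c x
  proof -
    have "N +>\<^bsub>V\<^esub> (c \<odot>\<^bsub>V\<^esub> y) = N +>\<^bsub>V\<^esub> (c \<odot>\<^bsub>V\<^esub> x)" if "y \<in> N +>\<^bsub>V\<^esub> x" for y
    proof -
      from that obtain h where h: "h \<in> N" "y = h \<oplus>\<^bsub>V\<^esub> x" by (auto simp: a_r_coset_def')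
      then have "c \<odot>\<^bsub>V\<^esub> y \<in> N +>\<^bsub>V\<^esub> (c \<odot>\<^bsub>V\<^esub> x)"
        using c x sub by (auto simp: V.smult_r_distr subset_iff submodule_def a_r_coset_def')
      then show ?thesis using c x by (intro S.a_repr_independence'[symmetric]) auto
    qed
    then have "(\<Union>y\<in>N +>\<^bsub>V\<^esub> x. N +>\<^bsub>V\<^esub> (c \<odot>\<^bsub>V\<^esub> y)) = N +>\<^bsub>V\<^esub> (c \<odot>\<^bsub>V\<^esub> x)"
      using S.a_rcos_self[OF x] by blast
    then show ?thesis by (simp add: quotient_module_def)
  qed
  show ?thesis
    using assms by (simp add: smult) (simp add: quotient_module_def S.a_rcos_sum)
qed

text \<open>Reduces the basis property to conditions on representatives modulo \<open>N\<close>,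
  which for cohomology means cocycles modulo coboundaries. Distinctness is a separate conclusion
  because equal cosets would turn the pair into a singleton.\<close>

lemma quotient_module_basis2:
  assumes V: "vectorspace K V" and N: "VectorSpace.subspace K N V"
    and u: "u \<in> carrier V" and v: "v \<in> carrier V"
    and spanning: "\<And>x. x \<in> carrier V \<Longrightarrow>
      \<exists>a\<in>carrier K. \<exists>b\<in>carrier K. \<exists>n\<in>N. x = n \<oplus>\<^bsub>V\<^esub> (a \<odot>\<^bsub>V\<^esub> u \<oplus>\<^bsub>V\<^esub> b \<odot>\<^bsub>V\<^esub> v)"
    and indep: "\<And>a b. a \<in> carrier K \<Longrightarrow> b \<in> carrier K \<Longrightarrow>
      a \<odot>\<^bsub>V\<^esub> u \<oplus>\<^bsub>V\<^esub> b \<odot>\<^bsub>V\<^esub> v \<in> N \<Longrightarrow> a = \<zero>\<^bsub>K\<^esub> \<and> b = \<zero>\<^bsub>K\<^esub>"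
  shows "N +>\<^bsub>V\<^esub> u \<noteq> N +>\<^bsub>V\<^esub> v"
    and "vectorspace.basis K (quotient_module V N) {N +>\<^bsub>V\<^esub> u, N +>\<^bsub>V\<^esub> v}"
proof -
  let ?Q = "quotient_module V N" and ?U = "N +>\<^bsub>V\<^esub> u" and ?V = "N +>\<^bsub>V\<^esub> v"
  interpret V: vectorspace K V by (fact V)
  interpret S: abelian_subgroup N V by (rule subspace_abelian_subgroup[OF V N])
  interpret Q: vectorspace K ?Q by (rule quotient_module_vectorspace[OF V N])
  have carrier_Q: "A \<in> carrier ?Q \<longleftrightarrow> (\<exists>x\<in>carrier V. A = N +>\<^bsub>V\<^esub> x)" for A
    by (auto simp: quotient_module_def A_RCOSETS_def RCOSETS_def a_r_coset_def)
  have U: "?U \<in> carrier ?Q" and V': "?V \<in> carrier ?Q" using u v carrier_Q by auto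
  note comb = quotient_module_lincomb2[OF V N u v]
  show ne: "?U \<noteq> ?V"
  proof
    assume "?U = ?V"
    \<comment> \<open>Equal cosets would give a vanishing combination with coefficients 1 and -1,
      against \<open>indep\<close>.\<close>
    then have "\<one>\<^bsub>K\<^esub> \<odot>\<^bsub>?Q\<^esub> ?U \<oplus>\<^bsub>?Q\<^esub> (\<ominus>\<^bsub>K\<^esub> \<one>\<^bsub>K\<^esub>) \<odot>\<^bsub>?Q\<^esub> ?V = \<zero>\<^bsub>?Q\<^esub>"
      using V' by (simp add: Q.smult_l_minus Q.r_neg)
    then have "N +>\<^bsub>V\<^esub> (\<one>\<^bsub>K\<^esub> \<odot>\<^bsub>V\<^esub> u \<oplus>\<^bsub>V\<^esub> (\<ominus>\<^bsub>K\<^esub> \<one>\<^bsub>K\<^esub>) \<odot>\<^bsub>V\<^esub> v) = \<zero>\<^bsub>?Q\<^esub>"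
      using comb[of "\<one>\<^bsub>K\<^esub>" "\<ominus>\<^bsub>K\<^esub> \<one>\<^bsub>K\<^esub>"] by simp
    then have "\<one>\<^bsub>K\<^esub> = \<zero>\<^bsub>K\<^esub>"
      using u v indep[of "\<one>\<^bsub>K\<^esub>" "\<ominus>\<^bsub>K\<^esub> \<one>\<^bsub>K\<^esub>"] quotient_module_zero_iff[OF V N] by simp
    then show False by simp
  qed
  have lc: "Q.lincomb f {?U, ?V} = f ?U \<odot>\<^bsub>?Q\<^esub> ?U \<oplus>\<^bsub>?Q\<^esub> f ?V \<odot>\<^bsub>?Q\<^esub> ?V"
    if "f ?U \<in> carrier K" "f ?V \<in> carrier K" for f
    using that U V' ne by (simp add: Q.lincomb_def)
  have "Q.lin_indpt {?U, ?V}"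
  proof (rule Q.finite_lin_indpt2)
    fix f assume f: "f \<in> {?U, ?V} \<rightarrow> carrier K" and "Q.lincomb f {?U, ?V} = \<zero>\<^bsub>?Q\<^esub>"
    then have "N +>\<^bsub>V\<^esub> (f ?U \<odot>\<^bsub>V\<^esub> u \<oplus>\<^bsub>V\<^esub> f ?V \<odot>\<^bsub>V\<^esub> v) = \<zero>\<^bsub>?Q\<^esub>"
      by (simp add: lc comb)
    with f show "\<forall>w\<in>{?U, ?V}. f w = \<zero>\<^bsub>K\<^esub>"
      using u v indep[of "f ?U" "f ?V"] quotient_module_zero_iff[OF V N] by simp
  qed (use U V' in auto)
  moreover have "Q.span {?U, ?V} = carrier ?Q"
  proof
    show "Q.span {?U, ?V} \<subseteq> carrier ?Q" using U V' by (intro Q.span_is_subset2) auto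
    show "carrier ?Q \<subseteq> Q.span {?U, ?V}"
    proof
      fix A assume "A \<in> carrier ?Q"
      then obtain x where x: "x \<in> carrier V" "A = N +>\<^bsub>V\<^esub> x" by (auto simp: carrier_Q)
      obtain a b n where ab: "a \<in> carrier K" "b \<in> carrier K" "n \<in> N"
        and x_eq: "x = n \<oplus>\<^bsub>V\<^esub> (a \<odot>\<^bsub>V\<^esub> u \<oplus>\<^bsub>V\<^esub> b \<odot>\<^bsub>V\<^esub> v)"
        using spanning[OF x(1)] by blast
      \<comment> \<open>Since the two cosets differ by \<open>ne\<close>, this function takes the
        value \<open>b\<close> at \<open>?V\<close>.\<close>
      let ?f = "\<lambda>w. if w = ?U then a else b"
      have "x \<in> N +>\<^bsub>V\<^esub> (a \<odot>\<^bsub>V\<^esub> u \<oplus>\<^bsub>V\<^esub> b \<odot>\<^bsub>V\<^esub> v)"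
        using ab x_eq by (auto simp: a_r_coset_def')
      then have "A = N +>\<^bsub>V\<^esub> (a \<odot>\<^bsub>V\<^esub> u \<oplus>\<^bsub>V\<^esub> b \<odot>\<^bsub>V\<^esub> v)"
        unfolding x(2) using ab u v by (intro S.a_repr_independence'[symmetric]) auto
      also have "\<dots> = Q.lincomb ?f {?U, ?V}"
        using ab ne lc[of ?f] by (simp add: comb)
      finally show "A \<in> Q.span {?U, ?V}"
        unfolding Q.span_def using ab by (auto intro!: exI[of _ ?f] exI[of _ "{?U, ?V}"])
    qed
  qed
  ultimately show "Q.basis {?U, ?V}" using U V' by (simp add: Q.basis_def)
qed

section \<open>The functional equations of the structure constants\<close>

text \<open>Both \<open>m\<close> and \<open>m ^ 3 - m\<close> solve the linear equation, and a
  solution is determined by its values at 1 and 2. Subtracting the combination with the same two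
  values leaves a solution \<open>d\<close> that vanishes everywhere.\<close>

lemma cubic_functional_equation:
  fixes h :: "int \<Rightarrow> complex"
  assumes h: "\<And>m n. of_int (m - n) * h (m + n) = of_int (m + 2 * n) * h m - of_int (2 * m + n) * h n"
  shows "h m = of_int m * h 1 + (h 2 - 2 * h 1) / 6 * of_int (m ^ 3 - m)"
proof -
  \<comment> \<open>\<open>m ^ 3 - m\<close> is 0 at 1 and 6 at 2, so this coefficient makes
    \<open>d\<close> vanish at both points.\<close>
  define c where "c = (h 2 - 2 * h 1) / 6"
  define d where "d m = h m - (of_int m * h 1 + c * of_int (m ^ 3 - m))" for m
  have d: "of_int (m - n) * d (m + n) = of_int (m + 2 * n) * d m - of_int (2 * m + n) * d n" for m n
  proof -
    have "of_int (m - n) * d (m + n) - (of_int (m + 2 * n) * d m - of_int (2 * m + n) * d n) =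
        of_int (m - n) * h (m + n) - (of_int (m + 2 * n) * h m - of_int (2 * m + n) * h n)"
      by (simp add: d_def algebra_simps power3_eq_cube)
    then show ?thesis using h[of m n] by simp
  qed
  have d1: "d 1 = 0" and d2: "d 2 = 0" by (simp_all add: d_def c_def field_simps)
  have d0: "d 0 = 0" using d[of 1 0] by simp
  have odd: "d (- m) = - d m" for m
  proof (cases "m = 0")
    case False
    have "of_int m * (d m + d (- m)) = 0"
      using d[of m "- m"] by (simp add: d0 algebra_simps)
    with False show ?thesis by (simp add: add_eq_0_iff)
  qed (simp add: d0)
  have pos: "d (int n) = 0" for n
  proof (induction n rule: nat_less_induct)
    case (1 n)
    \<comment> \<open>The recursion from \<open>n - 1\<close> to \<open>n\<close> carries the factor
      \<open>n - 2\<close>. It gives no information at 2, hence the separate initial value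
      \<open>d2\<close>.\<close>
    show ?case
    proof (cases "n \<le> 2")
      case True
      then have "n = 0 \<or> n = 1 \<or> n = 2" by auto
      then show ?thesis using d0 d1 d2 by auto
    next
      case False
      then have "d (int n - 1) = 0" using 1 by (auto simp: of_nat_diff dest!: spec[of _ "n - 1"])
      then have "of_int (int n - 2) * d (int n) = 0" using d[of "int n - 1" 1] d1 by simp
      moreover have "complex_of_nat n \<noteq> 2" using False of_nat_eq_iff[of n 2] by simp
      ultimately show ?thesis by simp
    qed
  qed
  have "d m = 0"
    using pos[of "nat m"] pos[of "nat (- m)"] odd[of m] by (cases "m \<ge> 0") auto
  then show ?thesis by (simp add: d_def c_def)
qed

text \<open>\<open>P m n\<close> stands for \<open>\<psi> (L m) (X n)\<close> with \<open>X\<close>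
  equal to \<open>L\<close> or \<open>I\<close>, and the assumption is the cocycle identity on
  \<open>L m\<close>, \<open>L n\<close>, \<open>X k\<close>. No symmetry of \<open>P\<close> is
  assumed, so both choices of \<open>X\<close> are covered. The term with \<open>g\<close> is the
  coboundary part.\<close>

lemma cocycle_functional_equation:
  fixes P :: "int \<Rightarrow> int \<Rightarrow> complex"
  assumes P: "\<And>m n k. of_int (m - n) * P (m + n) k - of_int (n - k) * P m (n + k)
      - of_int (k - m) * P n (k + m) = 0"
  obtains g c where "\<And>m n. P m n = of_int (m - n) * g (m + n) +
    c * (if m + n = 0 then of_int (m ^ 3 - m) / 12 else 0)"
proof
  define h where "h m = P m (- m)" for m
  \<comment> \<open>Comparing at \<open>m = 0\<close> forces \<open>P 0 s = - s * g s\<close>. For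
    \<open>s = 0\<close> the factor \<open>m - n\<close> equals \<open>2 * m\<close>, so the linear
    part \<open>m * h 1\<close> requires half of \<open>h 1\<close>.\<close>
  define g where "g s = (if s = 0 then h 1 / 2 else - P 0 s / of_int s)" for s
  have h: "of_int (m - n) * h (m + n) = of_int (m + 2 * n) * h m - of_int (2 * m + n) * h n" for m n
    using P[of m n "- (m + n)"] by (simp add: h_def algebra_simps)
  fix m n
  \<comment> \<open>The factor 2 converts the coefficient with denominator 6 to the normalisation
    with denominator 12.\<close>
  show "P m n = of_int (m - n) * g (m + n) +
      2 * (h 2 - 2 * h 1) * (if m + n = 0 then of_int (m ^ 3 - m) / 12 else 0)"
  proof (cases "m + n = 0")
    case True
    then have n: "n = - m" by simp
    have "P m n = h m" by (simp add: h_def n)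
    also have "\<dots> = of_int m * h 1 + (h 2 - 2 * h 1) / 6 * of_int (m ^ 3 - m)"
      by (rule cubic_functional_equation[OF h])
    finally show ?thesis by (simp add: n g_def)
  next
    case False
    \<comment> \<open>First index 0 corresponds to \<open>L 0\<close>, which acts diagonally on the
      basis; the total weight \<open>m + n\<close> can then be divided out.\<close>
    have "of_int (m + n) * P m n = of_int (n - m) * P 0 (m + n)"
      using P[of 0 m n] by (simp add: algebra_simps)
    moreover have "of_int (m + n) \<noteq> (0::complex)" using False of_int_eq_0_iff by blast
    ultimately have "P m n = of_int (n - m) * P 0 (m + n) / of_int (m + n)"
      by (metis nonzero_mult_div_cancel_left)
    also have "of_int (n - m) = - (of_int (m - n) :: complex)" by simp
    finally show ?thesis using False by (simp add: g_def del: of_int_diff)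
  qed
qed

section \<open>Bilinear forms and cocycles on a spanning set\<close>

lemma bilinear_form_simps:
  assumes "bilinear_form scale \<psi>"
  shows "\<psi> (x + x') y = \<psi> x y + \<psi> x' y" "\<psi> x (y + y') = \<psi> x y + \<psi> x y'"
    "\<psi> (scale c x) y = c * \<psi> x y" "\<psi> x (scale c y) = c * \<psi> x y" "\<psi> 0 y = 0" "\<psi> x 0 = 0"
proof -
  have l: "Vector_Spaces.linear scale (*) (\<psi> x)" "Vector_Spaces.linear scale (*) (\<lambda>x. \<psi> x y)" for x y
    using assms by (auto simp: bilinear_form_def)
  then show "\<psi> (x + x') y = \<psi> x y + \<psi> x' y" "\<psi> x (y + y') = \<psi> x y + \<psi> x y'"
    "\<psi> (scale c x) y = c * \<psi> x y" "\<psi> x (scale c y) = c * \<psi> x y"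
    by (simp_all add: Vector_Spaces.linear_iff)
  show "\<psi> 0 y = 0" "\<psi> x 0 = 0"
    using l(2)[of y] l(1)[of x] unfolding Vector_Spaces.linear_iff by (metis add_cancel_left_left)+
qed

lemma two_cocycleD:
  assumes "two_cocycle scale bracket \<psi>"
  shows "bilinear_form scale \<psi>" "\<psi> x y = - \<psi> y x"
    "\<psi> (bracket x y) z + \<psi> (bracket y z) x + \<psi> (bracket z x) y = 0"
  using assms unfolding two_cocycle_def skew_symmetric_def by blast+

lemma vector_space_complex: "vector_space ((*) :: complex \<Rightarrow> complex \<Rightarrow> complex)"
  by unfold_locales (auto simp: algebra_simps)

context complex_lie_algebra
begin

lemma complex_functional: "vector_space_pair scale ((*) :: complex \<Rightarrow> complex \<Rightarrow> complex)"
  by (intro vector_space_pair.intro vector_space_axioms vector_space_complex)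

lemma bilinear_formI:
  assumes "\<And>x x' y. \<psi> (x + x') y = \<psi> x y + \<psi> x' y" "\<And>x y y'. \<psi> x (y + y') = \<psi> x y + \<psi> x y'"
    and "\<And>c x y. \<psi> (scale c x) y = c * \<psi> x y" "\<And>c x y. \<psi> x (scale c y) = c * \<psi> x y"
  shows "bilinear_form scale \<psi>"
  using assms vector_space_axioms vector_space_complex
  by (simp add: bilinear_form_def Vector_Spaces.linear_iff)

lemma bracket_simps:
  "bracket (x + x') y = bracket x y + bracket x' y" "bracket x (y + y') = bracket x y + bracket x y'"
  "bracket (scale c x) y = scale c (bracket x y)" "bracket x (scale c y) = scale c (bracket x y)"
  using bracket_linear_left[of y] bracket_linear_right[of x]
  by (simp_all add: Vector_Spaces.linear_iff)

text \<open>Polarisation of \<open>bracket_self\<close>.\<close>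

lemma bracket_skew: "bracket x y = - bracket y x"
proof -
  have "bracket (x + y) (x + y) = bracket y x + bracket x y"
    by (simp only: bracket_simps bracket_self[of x] bracket_self[of y]) simp
  then have "bracket y x + bracket x y = 0" by (simp add: bracket_self)
  then show ?thesis by (metis eq_neg_iff_add_eq_0 add.commute)
qed

lemma bilinear_form_eqI:
  assumes \<phi>: "bilinear_form scale \<phi>" and \<psi>: "bilinear_form scale \<psi>" and B: "span B = UNIV"
    and eq: "\<And>x y. x \<in> B \<Longrightarrow> y \<in> B \<Longrightarrow> \<phi> x y = \<psi> x y"
  shows "\<phi> = \<psi>"
proof (intro ext)
  fix x y
  have "\<phi> x y = \<psi> x y" if "x \<in> B" for x y
    using \<phi> \<psi> that eq B
    by (intro vector_space_pair.linear_eq_on[OF complex_functional, of "\<phi> x" "\<psi> x" y B])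
      (auto simp: bilinear_form_def)
  then show "\<phi> x y = \<psi> x y"
    using \<phi> \<psi> B
    by (intro vector_space_pair.linear_eq_on[OF complex_functional, of "\<lambda>x. \<phi> x y" "\<lambda>x. \<psi> x y" x B])
      (auto simp: bilinear_form_def)
qed

text \<open>The cyclic sum \<open>F\<close> is linear in its last argument and invariant under
  rotation, so vanishing on \<open>B\<close> extends to the whole space one argument at a
  time.\<close>

lemma two_cocycleI_span:
  assumes \<psi>: "bilinear_form scale \<psi>" "skew_symmetric \<psi>" and B: "span B = UNIV"
    and J: "\<And>x y z. x \<in> B \<Longrightarrow> y \<in> B \<Longrightarrow> z \<in> B \<Longrightarrow>
      \<psi> (bracket x y) z + \<psi> (bracket y z) x + \<psi> (bracket z x) y = 0"
  shows "two_cocycle scale bracket \<psi>"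
proof -
  define F where "F x y z = \<psi> (bracket x y) z + \<psi> (bracket y z) x + \<psi> (bracket z x) y" for x y z
  have cyclic: "F x y z = F y z x" for x y z by (simp add: F_def)
  have lin: "Vector_Spaces.linear scale (*) (F x y)" for x y
    using vector_space_axioms vector_space_complex
    by (simp add: Vector_Spaces.linear_iff F_def bilinear_form_simps[OF \<psi>(1)]
        bracket_simps algebra_simps)
  have extend: "F x y z = 0" if "\<And>z. z \<in> B \<Longrightarrow> F x y z = 0" for x y z
    using vector_space_pair.linear_eq_0_on_span[OF complex_functional lin, where b = B] that B by auto
  have third: "F x y z = 0" if "x \<in> B" "y \<in> B" for x y z
    by (rule extend) (use J that in \<open>simp add: F_def\<close>)
  have second: "F z x y = 0" if "x \<in> B" for x y z
    by (rule extend) (simp add: cyclic[of z x] third that)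
  have "F x y z = 0" for x y z
    by (rule extend) (simp add: cyclic[of x y] second)
  then show ?thesis using \<psi> by (simp add: two_cocycle_def F_def)
qed

end

section \<open>Cocycles on W\<close>

context lie_algebra_W
begin

lemma bracket_I_L: "bracket (I m) (L n) = scale (of_int (m - n)) (I (m + n))"
proof -
  have "bracket (I m) (L n) = - scale (of_int (n - m)) (I (n + m))"
    by (subst bracket_skew) (simp only: bracket_L_I)
  also have "\<dots> = scale (of_int (m - n)) (I (m + n))"
    by (subst scale_minus_left[symmetric]) (simp add: add.commute)
  finally show ?thesis .
qed

text \<open>Treats \<alpha> (\<open>a = 1\<close>, \<open>b = 0\<close>) and \<beta>
  (\<open>a = 0\<close>, \<open>b = 1\<close>) together. Triples with at least two vectors
  \<open>I\<close> are trivial; the others reduce to one polynomial identity in the indices.\<close>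

lemma two_cocycle_virasoro:
  assumes \<psi>: "bilinear_form scale \<psi>" "skew_symmetric \<psi>"
    and L_L: "\<And>m n. \<psi> (L m) (L n) = a * (if m + n = 0 then of_int (m ^ 3 - m) / 12 else 0)"
    and L_I: "\<And>m n. \<psi> (L m) (I n) = b * (if m + n = 0 then of_int (m ^ 3 - m) / 12 else 0)"
    and I_I: "\<And>m n. \<psi> (I m) (I n) = 0"
  shows "two_cocycle scale bracket \<psi>"
proof (rule two_cocycleI_span[OF \<psi> basis_span])
  have I_L: "\<psi> (I n) (L m) = - (b * (if m + n = 0 then of_int (m ^ 3 - m) / 12 else 0))" for m n
    using \<psi>(2) unfolding skew_symmetric_def by (metis L_I)
  \<comment> \<open>The grouping of the index sums and the inner minus signs reproduce the unfolded
    cocycle identity literally for both \<open>L_L_L\<close> and \<open>L_L_I\<close>.\<close>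
  have Jacobi: "of_int (m - n) * (c * (if m + n + k = 0 then of_int ((m + n) ^ 3 - (m + n)) / 12 else 0))
      + of_int (n - k) * - (c * (if m + (n + k) = 0 then of_int (m ^ 3 - m) / 12 else 0))
      + of_int (k - m) * - (c * (if n + (k + m) = 0 then of_int (n ^ 3 - n) / 12 else 0)) = 0" (is "?lhs = 0")
    for m n k :: int and c :: complex
  proof (cases "m + n + k = 0")
    case True
    then have zero: "m + (n + k) = 0" "n + (k + m) = 0" and k: "k = - m - n" by simp_all
    \<comment> \<open>Collects everything into a single integer factor, so that the polynomial
      identity is checked over the integers.\<close>
    have combine: "of_int r * (c * (of_int p / 12)) + of_int s * - (c * (of_int q / 12))
        + of_int t * - (c * (of_int u / 12)) = c / 12 * of_int (r * p - s * q - t * u)" for r s t p q u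
      by (simp add: algebra_simps)
    have "?lhs = c / 12 * of_int ((m - n) * ((m + n) ^ 3 - (m + n))
        - (n - k) * (m ^ 3 - m) - (k - m) * (n ^ 3 - n))"
      unfolding if_P[OF True] if_P[OF zero(1)] if_P[OF zero(2)] combine ..
    also have "(m - n) * ((m + n) ^ 3 - (m + n)) - (n - k) * (m ^ 3 - m) - (k - m) * (n ^ 3 - n) = 0"
      by (simp add: k algebra_simps power3_eq_cube)
    finally show ?thesis by simp
  qed (simp add: algebra_simps)
  let ?J = "\<lambda>x y z. \<psi> (bracket x y) z + \<psi> (bracket y z) x + \<psi> (bracket z x) y"
  \<comment> \<open>Up to rotation, the only patterns of three basis vectors are
    \<open>L L L\<close>, \<open>L L I\<close>, \<open>L I I\<close> and
    \<open>I I I\<close>.\<close>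
  have rotate: "?J y z x = 0" if "?J x y z = 0" for x y z
    using that by (simp only: add.assoc add.commute add.left_commute)
  have skew: "\<psi> x y = - \<psi> y x" for x y
    using \<psi>(2) unfolding skew_symmetric_def by blast
  have L_L_L: "?J (L m) (L n) (L k) = 0" for m n k
    using Jacobi[of m n a k]
    unfolding bracket_L_L bilinear_form_simps[OF \<psi>(1)]
      skew[of "L (n + k)" "L m"] skew[of "L (k + m)" "L n"]
    unfolding L_L .
  have L_L_I: "?J (L m) (L n) (I k) = 0" for m n k
    using Jacobi[of m n b k]
    unfolding bracket_L_L bracket_L_I bracket_I_L bilinear_form_simps[OF \<psi>(1)] L_I I_L .
  have L_I_I: "?J (L m) (I n) (I k) = 0" for m n k
    unfolding bracket_L_I bracket_I_L bracket_I_I bilinear_form_simps[OF \<psi>(1)] I_I by simp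
  have I_I_I: "?J (I m) (I n) (I k) = 0" for m n k
    unfolding bracket_I_I bilinear_form_simps[OF \<psi>(1)] by simp
  fix x y z assume "x \<in> range L \<union> range I" "y \<in> range L \<union> range I" "z \<in> range L \<union> range I"
  then show "?J x y z = 0"
    using L_L_L L_L_I L_L_I[THEN rotate] L_L_I[THEN rotate, THEN rotate]
      L_I_I L_I_I[THEN rotate] L_I_I[THEN rotate, THEN rotate] I_I_I
    by (elim UnE imageE) (simp_all only:)
qed

text \<open>As the vectors \<open>I\<close> commute, the identity on \<open>L k\<close>,
  \<open>I m\<close>, \<open>I n\<close> has only two terms. Taking \<open>k = 0\<close> settles
  nonzero weight \<open>m + n\<close>.\<close>

lemma two_cocycle_I_I:
  assumes "two_cocycle scale bracket \<psi>"
  shows "\<psi> (I m) (I n) = 0"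
proof -
  have \<psi>: "bilinear_form scale \<psi>" and skew: "\<And>x y. \<psi> x y = - \<psi> y x"
    and J: "\<And>x y z. \<psi> (bracket x y) z + \<psi> (bracket y z) x + \<psi> (bracket z x) y = 0"
    using two_cocycleD[OF assms] by blast+
  have eq: "of_int (k - m) * \<psi> (I (k + m)) (I n) + of_int (n - k) * \<psi> (I (n + k)) (I m) = 0" for k m n
    using J[of "L k" "I m" "I n"]
    by (simp only: bracket_L_I bracket_I_L bracket_I_I bilinear_form_simps[OF \<psi>]) simp
  show ?thesis
  proof (cases "m + n = 0")
    case False
    have "of_int (m + n) * \<psi> (I m) (I n) = 0"
      using eq[of 0 m n] skew[of "I n" "I m"] by (simp add: algebra_simps neg_eq_iff_add_eq_0)
    moreover have "of_int (m + n) \<noteq> (0::complex)" using False of_int_eq_0_iff by blast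
    ultimately show ?thesis by (metis mult_eq_0_iff)
  next
    case True
    then have n: "n = - m" by simp
    \<comment> \<open>For opposite indices, \<open>L (- m)\<close> moves \<open>I m\<close> to
      \<open>I 0\<close>, so the value is tied to this one, which vanishes by skew symmetry.\<close>
    have "\<psi> (I 0) (I 0) = 0" using skew[of "I 0" "I 0"] by simp
    then have "of_int m * \<psi> (I m) (I (- m)) = 0"
      using eq[of "- m" m 0] skew[of "I (- m)" "I m"] by simp
    then show ?thesis using \<open>\<psi> (I 0) (I 0) = 0\<close> by (cases "m = 0") (auto simp: n)
  qed
qed

text \<open>The family \<open>X\<close> is a parameter because \<open>L\<close> acts on the vectors
  \<open>L\<close> and on the vectors \<open>I\<close> by the same formula.\<close>

lemma two_cocycle_L:
  assumes "two_cocycle scale bracket \<psi>"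
    and L_X: "\<And>m n. bracket (L m) (X n) = scale (of_int (m - n)) (X (m + n))"
    and X_L: "\<And>m n. bracket (X m) (L n) = scale (of_int (m - n)) (X (m + n))"
  obtains g c where "\<And>m n. \<psi> (L m) (X n) = of_int (m - n) * g (m + n) +
    c * (if m + n = 0 then of_int (m ^ 3 - m) / 12 else 0)"
proof (rule cocycle_functional_equation)
  have \<psi>: "bilinear_form scale \<psi>" and skew: "\<And>x y. \<psi> x y = - \<psi> y x"
    and J: "\<And>x y z. \<psi> (bracket x y) z + \<psi> (bracket y z) x + \<psi> (bracket z x) y = 0"
    using two_cocycleD[OF assms(1)] by blast+
  show "of_int (m - n) * \<psi> (L (m + n)) (X k) - of_int (n - k) * \<psi> (L m) (X (n + k))
      - of_int (k - m) * \<psi> (L n) (X (k + m)) = 0" for m n k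
    using J[of "L m" "L n" "X k"] skew[of "X (n + k)" "L m"] skew[of "X (k + m)" "L n"]
    by (simp add: bracket_L_L L_X X_L bilinear_form_simps[OF \<psi>])
qed (use that in blast)

lemma linear_functional_extend:
  obtains f where "Vector_Spaces.linear scale ((*) :: complex \<Rightarrow> complex \<Rightarrow> complex) f"
    "\<And>m. f (L m) = g m" "\<And>m. f (I m) = h m"
proof -
  \<comment> \<open>Injectivity recovers the index through \<open>the_inv\<close>, and disjointness
    of the ranges makes the case distinction unambiguous.\<close>
  let ?\<phi> = "\<lambda>w. if w \<in> range L then g (the_inv L w) else h (the_inv I w)"
  obtain f where f: "Vector_Spaces.linear scale (*) f" "\<forall>w\<in>range L \<union> range I. f w = ?\<phi> w"
    using vector_space_pair.linear_independent_extend[OF complex_functional basis_independent, of ?\<phi>] by blast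
  have "f (L m) = g m" for m using f(2) by (simp add: the_inv_f_f inj_L)
  moreover have "f (I m) = h m" for m
    using f(2) L_I_disjoint by (auto simp: the_inv_f_f inj_I)
  ultimately show ?thesis using f(1) that by blast
qed

text \<open>The functions \<open>g\<close> and \<open>h\<close> found for the pairs
  \<open>L L\<close> and \<open>L I\<close> become the values of \<open>f\<close> on the basis; the
  remaining multiples of the cubic term are the coefficients of \<alpha> and \<beta>. Agreement on
  basis pairs then suffices by bilinearity.\<close>

lemma two_cocycle_decomposition:
  assumes \<alpha>: "bilinear_form scale \<alpha>" "skew_symmetric \<alpha>"
      "\<And>m n. \<alpha> (L m) (L n) = (if m + n = 0 then of_int (m ^ 3 - m) / 12 else 0)"
      "\<And>m n. \<alpha> (L m) (I n) = 0"
      "\<And>m n. \<alpha> (I m) (I n) = 0"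
    and \<beta>: "bilinear_form scale \<beta>" "skew_symmetric \<beta>"
      "\<And>m n. \<beta> (L m) (I n) = (if m + n = 0 then of_int (m ^ 3 - m) / 12 else 0)"
      "\<And>m n. \<beta> (L m) (L n) = 0"
      "\<And>m n. \<beta> (I m) (I n) = 0"
    and \<psi>: "two_cocycle scale bracket \<psi>"
  obtains a b f where "Vector_Spaces.linear scale (*) f"
    "\<psi> = (\<lambda>x y. f (bracket x y) + (a * \<alpha> x y + b * \<beta> x y))"
proof -
  obtain g a where LL: "\<And>m n. \<psi> (L m) (L n) = of_int (m - n) * g (m + n) +
      a * (if m + n = 0 then of_int (m ^ 3 - m) / 12 else 0)"
    using two_cocycle_L[where X = L, OF \<psi> bracket_L_L bracket_L_L] by blast
  obtain h b where LI: "\<And>m n. \<psi> (L m) (I n) = of_int (m - n) * h (m + n) +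
      b * (if m + n = 0 then of_int (m ^ 3 - m) / 12 else 0)"
    using two_cocycle_L[where X = I, OF \<psi> bracket_L_I bracket_I_L] by blast
  obtain f where f: "Vector_Spaces.linear scale (*) f" "\<And>m. f (L m) = g m" "\<And>m. f (I m) = h m"
    using linear_functional_extend by blast
  have f_simps: "f (x + y) = f x + f y" "f (scale c x) = c * f x" "f 0 = 0" "f (- x) = - f x" for x y c
    using f(1) by (simp_all add: Vector_Spaces.linear_iff vector_space_pair.linear_0[OF complex_functional]
        vector_space_pair.linear_neg[OF complex_functional])
  define \<phi> where "\<phi> = (\<lambda>x y. f (bracket x y) + (a * \<alpha> x y + b * \<beta> x y))"
  have skew: "\<psi> x y = - \<psi> y x" "\<phi> x y = - \<phi> y x" for x y
  proof -
    show "\<psi> x y = - \<psi> y x" by (rule two_cocycleD(2)[OF \<psi>])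
    have "\<alpha> x y = - \<alpha> y x" "\<beta> x y = - \<beta> y x"
      using \<alpha>(2) \<beta>(2) unfolding skew_symmetric_def by blast+
    then show "\<phi> x y = - \<phi> y x"
      using bracket_skew[of x y] by (simp add: \<phi>_def f_simps)
  qed
  have L_L: "\<psi> (L m) (L n) = \<phi> (L m) (L n)" for m n
    by (simp add: \<phi>_def LL bracket_L_L f_simps f \<alpha> \<beta>)
  have L_I: "\<psi> (L m) (I n) = \<phi> (L m) (I n)" for m n
    by (simp add: \<phi>_def LI bracket_L_I f_simps f \<alpha> \<beta>)
  have I_L: "\<psi> (I n) (L m) = \<phi> (I n) (L m)" for m n
    using L_I skew by metis
  have I_I: "\<psi> (I m) (I n) = \<phi> (I m) (I n)" for m n
    by (simp add: \<phi>_def two_cocycle_I_I[OF \<psi>] bracket_I_I f_simps \<alpha> \<beta>)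
  have "bilinear_form scale \<phi>"
    by (rule bilinear_formI)
      (simp_all add: \<phi>_def f_simps bracket_simps bilinear_form_simps[OF \<alpha>(1)]
        bilinear_form_simps[OF \<beta>(1)] algebra_simps)
  moreover have "bilinear_form scale \<psi>" using \<psi> by (simp add: two_cocycle_def)
  ultimately have "\<psi> = \<phi>"
    using L_L L_I I_L I_I by (intro bilinear_form_eqI[OF _ _ basis_span]) auto
  with f(1) that show ?thesis unfolding \<phi>_def by blast
qed

end

section \<open>Cohomology classes of \<alpha> and \<beta>\<close>

theorem theorem2p3:
  fixes scale :: "complex \<Rightarrow> 'w::ab_group_add \<Rightarrow> 'w"
    and bracket :: "'w \<Rightarrow> 'w \<Rightarrow> 'w"
    and L I :: "int \<Rightarrow> 'w"
    and \<alpha> \<beta> :: "'w \<Rightarrow> 'w \<Rightarrow> complex"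
  assumes W: "lie_algebra_W scale bracket L I"
    and \<alpha>: "bilinear_form scale \<alpha>" "skew_symmetric \<alpha>"
      "\<And>m n. \<alpha> (L m) (L n) = (if m + n = 0 then of_int (m ^ 3 - m) / 12 else 0)"
      "\<And>m n. \<alpha> (L m) (I n) = 0"
      "\<And>m n. \<alpha> (I m) (I n) = 0"
    and \<beta>: "bilinear_form scale \<beta>" "skew_symmetric \<beta>"
      "\<And>m n. \<beta> (L m) (I n) = (if m + n = 0 then of_int (m ^ 3 - m) / 12 else 0)"
      "\<And>m n. \<beta> (L m) (L n) = 0"
      "\<And>m n. \<beta> (I m) (I n) = 0"
  shows "two_cocycle scale bracket \<alpha> \<and> two_cocycle scale bracket \<beta> \<and>
    H2_class scale bracket \<alpha> \<noteq> H2_class scale bracket \<beta> \<and>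
    vectorspace.basis class_ring (H2 scale bracket)
      {H2_class scale bracket \<alpha>, H2_class scale bracket \<beta>}"
proof -
  interpret lie_algebra_W scale bracket L I by (fact W)
  let ?Z = "Z2 scale bracket" and ?B = "B2 scale bracket"
  have cocycle_\<alpha>: "two_cocycle scale bracket \<alpha>"
    by (rule two_cocycle_virasoro[where a = 1 and b = 0]) (simp_all only: \<alpha> mult_1_left mult_zero_left)
  have cocycle_\<beta>: "two_cocycle scale bracket \<beta>"
    by (rule two_cocycle_virasoro[where a = 0 and b = 1]) (simp_all only: \<beta> mult_1_left mult_zero_left)
  have spanning: "\<exists>a b. \<exists>\<phi>\<in>?B. \<psi> = \<phi> \<oplus>\<^bsub>?Z\<^esub> (a \<odot>\<^bsub>?Z\<^esub> \<alpha> \<oplus>\<^bsub>?Z\<^esub> b \<odot>\<^bsub>?Z\<^esub> \<beta>)"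
    if "\<psi> \<in> carrier ?Z" for \<psi>
  proof -
    have "two_cocycle scale bracket \<psi>" using that by (simp add: Z2_def)
    then obtain a b f where f: "Vector_Spaces.linear scale (*) f"
      and eq: "\<psi> = (\<lambda>x y. f (bracket x y) + (a * \<alpha> x y + b * \<beta> x y))"
      using two_cocycle_decomposition[OF \<alpha> \<beta>] by blast
    have f_simps: "f (x + y) = f x + f y" "f (scale c x) = c * f x" "f 0 = 0" "f (- x) = - f x"
      for x y c
      using f by (simp_all add: Vector_Spaces.linear_iff vector_space_pair.linear_0[OF complex_functional]
          vector_space_pair.linear_neg[OF complex_functional])
    \<comment> \<open>Membership in \<open>B2\<close> includes being a cocycle; for \<open>f\<close>
      composed with the bracket this is the Jacobi identity under \<open>f\<close>.\<close>
    have "two_cocycle scale bracket (\<lambda>x y. f (bracket x y))"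
      unfolding two_cocycle_def skew_symmetric_def
    proof (intro conjI allI)
      show "bilinear_form scale (\<lambda>x y. f (bracket x y))"
        by (rule bilinear_formI) (simp_all add: f_simps bracket_simps)
      show "f (bracket x y) = - f (bracket y x)" for x y
        by (subst bracket_skew) (rule f_simps)
      show "f (bracket (bracket x y) z) + f (bracket (bracket y z) x) + f (bracket (bracket z x) y) = 0"
        for x y z
        by (simp only: jacobi f_simps(3) f_simps(1)[symmetric])
    qed
    then have "(\<lambda>x y. f (bracket x y)) \<in> ?B"
      using f by (auto simp: B2_def two_coboundary_def)
    then show ?thesis
      using eq by (intro exI[of _ a] exI[of _ b] bexI[of _ "\<lambda>x y. f (bracket x y)"]) (simp_all add: Z2_def)
  qed
  have indep: "a = 0 \<and> b = 0"
    if "a \<odot>\<^bsub>?Z\<^esub> \<alpha> \<oplus>\<^bsub>?Z\<^esub> b \<odot>\<^bsub>?Z\<^esub> \<beta> \<in> ?B" for a b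
  proof -
    have "(\<lambda>x y. a * \<alpha> x y + b * \<beta> x y) \<in> ?B" using that by (simp add: Z2_def)
    then obtain f where f: "Vector_Spaces.linear scale (*) f"
      and "(\<lambda>x y. a * \<alpha> x y + b * \<beta> x y) = (\<lambda>x y. f (bracket x y))"
      unfolding B2_def two_coboundary_def by blast
    then have eq: "a * \<alpha> x y + b * \<beta> x y = f (bracket x y)" for x y by meson
    have f_scale: "f (scale c x) = c * f x" for c x using f by (simp add: Vector_Spaces.linear_iff)
    \<comment> \<open>The cubic term is 0 at 1, giving \<open>2 * f (L 0) = 0\<close> and
      \<open>2 * f (I 0) = 0\<close>. At 2 it is 6 / 12, giving \<open>a / 2 = 4 * f (L 0)\<close>
      and \<open>b / 2 = 4 * f (I 0)\<close>.\<close>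
    show ?thesis
      using eq[of "L 1" "L (- 1)"] eq[of "L 2" "L (- 2)"] eq[of "L 1" "I (- 1)"] eq[of "L 2" "I (- 2)"]
      by (simp add: \<alpha> \<beta> bracket_L_L bracket_L_I f_scale)
  qed
  have "H2_class scale bracket \<alpha> \<noteq> H2_class scale bracket \<beta> \<and>
    vectorspace.basis class_ring (H2 scale bracket)
      {H2_class scale bracket \<alpha>, H2_class scale bracket \<beta>}"
    unfolding H2_def H2_class_def
    using quotient_module_basis2[OF Z2_vectorspace[OF complex_lie_algebra_axioms]
        B2_subspace[OF complex_lie_algebra_axioms], of \<alpha> \<beta>]
      cocycle_\<alpha> cocycle_\<beta> spanning indep by (simp add: Z2_def)
  then show ?thesis using cocycle_\<alpha> cocycle_\<beta> by blast
qed

end
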